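(* Let $x\geq 3$ be an odd integer. Then there exists a standard linear realization of $\{1^a,x^b,(x+1)^c\}$ in each of the following cases: (1) $b,c\geq 0$ and $a\geq 3x-3$; (2) $b,c\geq 0$ and $a\geq b+2x-3$; (3) $b\geq 0$, $c\geq \frac{4b}{3}$ and $a\geq 2x-2$.
   Context: The notation $\{1^{a_1},\ldots,t^{a_t}\}$ denotes the multiset with $a_i$ copies of $i$. For a list (multiset) $L$ of positive integers with $|L|$ elements, a linear realization of $L$ is an ordering $[x_0,\ldots,x_{|L|}]$ of $\{0,1,\ldots,|L|\}$ such that the multiset $\{|x_i-x_{i+1}|:0\le i\le |L|-1\}$ equals $L$; it is standard if $x_0=0$. All exponents are integers. *)

theory Defs
  imports Complex_Main "HOL-Library.Multiset"
begin

definition linear_realization :: "nat list \<Rightarrow> nat multiset \<Rightarrow> bool" where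
  "linear_realization xs L \<longleftrightarrow>
     distinct xs \<and> set xs = {0..size L} \<and>
     {# nat \<bar>int (xs ! i) - int (xs ! (i + 1))\<bar>. i \<in># mset_set {0..<size L} #} = L"

definition standard_linear_realization :: "nat list \<Rightarrow> nat multiset \<Rightarrow> bool" where
  "standard_linear_realization xs L \<longleftrightarrow> linear_realization xs L \<and> xs ! 0 = 0"

end

theory Submission
  imports Defs
begin

text \<open>
  A perfect realization (from \<open>0\<close> to the largest label) followed by a shifted standard one is
  standard. For odd \<open>x\<close> the lists \<open>{1^(x-1), x^(qx)}\<close> and \<open>{1^(x-r), x^r, (x+1)^(x+1)}\<close> with \<open>r\<close>
  odd are perfect; the case \<open>r = x\<close> uses no \<open>1\<close> at all. Splitting off such blocks reduces all three
  cases to \<open>b < x\<close> and \<open>a = 2x-2\<close>. If moreover \<open>c > x\<close>, another perfect block leaves at most one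
  \<open>x\<close>, and the rest is a boustrophedon path through the residue classes modulo \<open>x+1\<close>. If \<open>c \<le> x\<close>,
  the path lives on the two rows \<open>0..x\<close> and \<open>x+1..2x+1\<close>: in the zigzag order \<open>0, x+1, 1, x+2, \<dots>\<close>
  consecutive labels differ alternately by \<open>x+1\<close> and \<open>x\<close>, and labels two apart differ by \<open>1\<close>.
\<close>

section \<open>Walks with prescribed step lengths\<close>

text \<open>
  \<open>S\<close> is only a lower bound for the set of visited labels, and repetitions are not excluded: a walk
  with \<open>n\<close> steps that covers \<open>{0..n}\<close> is Hamiltonian by counting.
\<close>

inductive walk :: "nat \<Rightarrow> nat \<Rightarrow> nat \<Rightarrow> nat set \<Rightarrow> nat \<Rightarrow> nat \<Rightarrow> nat \<Rightarrow> bool"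
  for x where
  start: "S \<subseteq> {u} \<Longrightarrow> walk x u u S 0 0 0"
| step_1: "walk x u v S a b c \<Longrightarrow> w = v + 1 \<or> v = w + 1 \<Longrightarrow> T \<subseteq> insert w S
    \<Longrightarrow> walk x u w T (Suc a) b c"
| step_x: "walk x u v S a b c \<Longrightarrow> w = v + x \<or> v = w + x \<Longrightarrow> T \<subseteq> insert w S
    \<Longrightarrow> walk x u w T a (Suc b) c"
| step_y: "walk x u v S a b c \<Longrightarrow> w = v + (x + 1) \<or> v = w + (x + 1) \<Longrightarrow> T \<subseteq> insert w S
    \<Longrightarrow> walk x u w T a b (Suc c)"

lemma walk_mono: "walk x u v S a b c \<Longrightarrow> T \<subseteq> S \<Longrightarrow> walk x u v T a b c"
  by (induction arbitrary: T rule: walk.induct) (blast intro: walk.intros)+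

text \<open>The recorded set may omit the endpoint, but the last rule applied also permits a set
  containing it. This settles the base case of concatenation.\<close>

lemma walk_insert_end: "walk x u v S a b c \<Longrightarrow> walk x u v (insert v S) a b c"
  by (erule walk.cases) (blast intro: walk.intros)+

lemma walk_trans:
  assumes "walk x u v S a b c" "walk x v w S' a' b' c'"
  shows "walk x u w (S \<union> S') (a + a') (b + b') (c + c')"
  using assms(2,1)
proof (induction rule: walk.induct)
  case (start S' v)
  then show ?case
    using walk_mono[OF walk_insert_end[OF start(2)], of "S \<union> S'"] by auto
next
  case (step_1 v v' S' a' b' c' w T)
  show ?case
    using walk.step_1[OF step_1(4)[OF step_1(5)] step_1(2), of "S \<union> T"] step_1(3) by auto
next
  case (step_x v v' S' a' b' c' w T)
  show ?case
    using walk.step_x[OF step_x(4)[OF step_x(5)] step_x(2), of "S \<union> T"] step_x(3) by auto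
next
  case (step_y v v' S' a' b' c' w T)
  show ?case
    using walk.step_y[OF step_y(4)[OF step_y(5)] step_y(2), of "S \<union> T"] step_y(3) by auto
qed

lemma walk_append:
  assumes "walk x u v S a b c" "walk x v w S' a' b' c'"
    and "T \<subseteq> S \<union> S'" "A = a + a'" "B = b + b'" "C = c + c'"
  shows "walk x u w T A B C"
  using walk_mono[OF walk_trans[OF assms(1,2)] assms(3)] assms(4-) by simp

text \<open>Set and counts of the result are tied to the inputs only by side conditions, so each use
  leaves inclusions and arithmetic. With \<open>walk_point\<close> as second walk it adds a single
  step.\<close>

lemma walk_join_1:
  assumes "walk x u v S a b c" "walk x v' w S' a' b' c'"
    and "v' = v + 1 \<or> v = v' + 1"
    and "T \<subseteq> S \<union> S'" "A = a + a' + 1" "B = b + b'" "C = c + c'"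
  shows "walk x u w T A B C"
  by (rule walk_append[OF step_1[OF assms(1,3) order_refl] assms(2)]) (use assms in auto)

lemma walk_join_x:
  assumes "walk x u v S a b c" "walk x v' w S' a' b' c'"
    and "v' = v + x \<or> v = v' + x"
    and "T \<subseteq> S \<union> S'" "A = a + a'" "B = b + b' + 1" "C = c + c'"
  shows "walk x u w T A B C"
  by (rule walk_append[OF step_x[OF assms(1,3) order_refl] assms(2)]) (use assms in auto)

lemma walk_join_y:
  assumes "walk x u v S a b c" "walk x v' w S' a' b' c'"
    and "v' = v + (x + 1) \<or> v = v' + (x + 1)"
    and "T \<subseteq> S \<union> S'" "A = a + a'" "B = b + b'" "C = c + c' + 1"
  shows "walk x u w T A B C"
  by (rule walk_append[OF step_y[OF assms(1,3) order_refl] assms(2)]) (use assms in auto)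

lemma walk_cong:
  assumes "walk x u v S a b c" "u = u'" "v = v'" "T \<subseteq> S" "a = a'" "b = b'" "c = c'"
  shows "walk x u' v' T a' b' c'"
  using walk_mono[OF assms(1,4)] assms by simp

lemma walk_point: "walk x u u {u} 0 0 0"
  by (rule start) simp

lemma walk_rev: "walk x u v S a b c \<Longrightarrow> walk x v u S a b c"
proof (induction rule: walk.induct)
  case (start S u)
  then show ?case by (rule walk.start)
next
  case (step_1 u v S a b c w T)
  show ?case by (rule walk_join_1[OF walk_point step_1(4)]) (use step_1 in auto)
next
  case (step_x u v S a b c w T)
  show ?case by (rule walk_join_x[OF walk_point step_x(4)]) (use step_x in auto)
next
  case (step_y u v S a b c w T)
  show ?case by (rule walk_join_y[OF walk_point step_y(4)]) (use step_y in auto)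
qed

lemma walk_shift: "walk x u v S a b c \<Longrightarrow> walk x (k + u) (k + v) ((+) k ` S) a b c"
proof (induction rule: walk.induct)
  case (start S u)
  then show ?case by (auto intro!: walk.start)
next
  case (step_1 u v S a b c w T)
  show ?case by (rule walk.step_1[OF step_1(4)]) (use step_1 in auto)
next
  case (step_x u v S a b c w T)
  show ?case by (rule walk.step_x[OF step_x(4)]) (use step_x in auto)
next
  case (step_y u v S a b c w T)
  show ?case by (rule walk.step_y[OF step_y(4)]) (use step_y in auto)
qed

lemma walk_run: "walk x u (u + k) {u..u + k} k 0 0"
proof (induction k)
  case 0
  then show ?case by (auto intro: walk_point)
next
  case (Suc k)
  show ?case by (rule step_1[OF Suc]) auto
qed

lemma walk_run_up: "u \<le> v \<Longrightarrow> walk x u v {u..v} (v - u) 0 0"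
  using walk_run[of x u "v - u"] by simp

lemma walk_run_down: "u \<le> v \<Longrightarrow> walk x v u {u..v} (v - u) 0 0"
  by (rule walk_rev[OF walk_run_up])

lemma walk_column_x: "walk x u (u + x * k) {u + x * t |t. t \<le> k} 0 k 0"
proof (induction k)
  case 0
  then show ?case by (auto intro: walk_point)
next
  case (Suc k)
  show ?case by (rule step_x[OF Suc]) (auto simp: le_Suc_eq)
qed

lemma walk_column_y: "walk x u (u + (x + 1) * k) {u + (x + 1) * t |t. t \<le> k} 0 0 k"
proof (induction k)
  case 0
  then show ?case by (auto intro: walk_point)
next
  case (Suc k)
  show ?case by (rule step_y[OF Suc]) (auto simp: le_Suc_eq)
qed

section \<open>Standard and perfect realizations and their concatenation\<close>

definition std :: "nat \<Rightarrow> nat \<Rightarrow> nat \<Rightarrow> nat \<Rightarrow> bool" where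
  "std x a b c \<longleftrightarrow> (\<exists>v. walk x 0 v {0..a + b + c} a b c)"

definition perfect :: "nat \<Rightarrow> nat \<Rightarrow> nat \<Rightarrow> nat \<Rightarrow> bool" where
  "perfect x a b c \<longleftrightarrow> walk x 0 (a + b + c) {0..a + b + c} a b c"

lemma stdI: "walk x 0 v S a b c \<Longrightarrow> {0..a + b + c} \<subseteq> S \<Longrightarrow> std x a b c"
  unfolding std_def using walk_mono by blast

text \<open>The shifted second walk starts at the largest label of the first. Leaving
  \<open>v\<close> arbitrary serves both \<open>perfect_std\<close> and
  \<open>perfect_perfect\<close>.\<close>

lemma perfect_walk_append:
  assumes "perfect x a b c" "walk x 0 v {0..a' + b' + c'} a' b' c'"
  shows "walk x 0 (a + b + c + v) {0..(a + a') + (b + b') + (c + c')} (a + a') (b + b') (c + c')"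
proof -
  let ?n = "a + b + c"
  have "walk x ?n (?n + v) ((+) ?n ` {0..a' + b' + c'}) a' b' c'"
    using walk_shift[OF assms(2), of ?n] by simp
  from assms(1)[unfolded perfect_def] this show ?thesis
  proof (rule walk_append)
    show "{0..(a + a') + (b + b') + (c + c')} \<subseteq> {0..?n} \<union> (+) ?n ` {0..a' + b' + c'}"
      by (auto simp: image_add_atLeastAtMost)
  qed auto
qed

lemma perfect_std:
  "perfect x a b c \<Longrightarrow> std x a' b' c' \<Longrightarrow> std x (a + a') (b + b') (c + c')"
  unfolding std_def using perfect_walk_append by blast

lemma perfect_perfect:
  "perfect x a b c \<Longrightarrow> perfect x a' b' c' \<Longrightarrow> perfect x (a + a') (b + b') (c + c')"
  using perfect_walk_append[of x a b c "a' + b' + c'" a' b' c']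
  by (simp add: perfect_def algebra_simps)

lemma perfect_power: "perfect x a b c \<Longrightarrow> perfect x (q * a) (q * b) (q * c)"
proof (induction q)
  case 0
  then show ?case by (auto simp: perfect_def intro: start)
next
  case (Suc q)
  then show ?case using perfect_perfect by auto
qed

text \<open>A run \<open>0, 1, ..., k\<close> is perfect, so surplus ones can be spent
  first.\<close>

lemma std_more_ones:
  assumes "std x a b c" "a \<le> a'"
  shows "std x a' b c"
proof -
  have "perfect x (a' - a) 0 0"
    using walk_run[of x 0 "a' - a"] by (simp add: perfect_def)
  from perfect_std[OF this assms(1)] show ?thesis using assms(2) by simp
qed

section \<open>From walks to lists\<close>

lemma walk_imp_list:
  assumes "walk x u v S a b c"
  shows "\<exists>xs. length xs = Suc (a + b + c) \<and> xs ! 0 = u \<and> xs ! (a + b + c) = v \<and> S \<subseteq> set xs \<and>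
    {# nat \<bar>int (xs ! i) - int (xs ! (i + 1))\<bar>. i \<in># mset_set {0..<a + b + c} #} =
      replicate_mset a 1 + replicate_mset b x + replicate_mset c (x + 1)"
proof -
  \<comment> \<open>Appending a label keeps the old differences and adds one; an arbitrary
    \<open>d\<close> covers all three kinds of step.\<close>
  have extend: "\<exists>ys. length ys = Suc (Suc n) \<and> ys ! 0 = u \<and> ys ! Suc n = w \<and> T \<subseteq> set ys \<and>
    {# nat \<bar>int (ys ! i) - int (ys ! (i + 1))\<bar>. i \<in># mset_set {0..<Suc n} #} = add_mset d M"
    if "length xs = Suc n" "xs ! 0 = u" "xs ! n = v" "S \<subseteq> set xs"
      "{# nat \<bar>int (xs ! i) - int (xs ! (i + 1))\<bar>. i \<in># mset_set {0..<n} #} = M"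
      "w = v + d \<or> v = w + d" "T \<subseteq> insert w S"
    for n u v w d S T M and xs :: "nat list"
  proof (intro exI conjI)
    let ?ys = "xs @ [w]"
    show "length ?ys = Suc (Suc n)" "?ys ! 0 = u" "?ys ! Suc n = w" "T \<subseteq> set ?ys"
      using that by (auto simp: nth_append)
    have "{# nat \<bar>int (?ys ! i) - int (?ys ! (i + 1))\<bar>. i \<in># mset_set {0..<n} #} =
      {# nat \<bar>int (xs ! i) - int (xs ! (i + 1))\<bar>. i \<in># mset_set {0..<n} #}"
      by (rule image_mset_cong) (use that in \<open>auto simp: nth_append\<close>)
    moreover have "nat \<bar>int (?ys ! n) - int (?ys ! (n + 1))\<bar> = d"
      using that by (auto simp: nth_append)
    moreover have "mset_set {0..<Suc n} = add_mset n (mset_set {0..<n})"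
      by (simp add: atLeast0_lessThan_Suc)
    ultimately show "{# nat \<bar>int (?ys ! i) - int (?ys ! (i + 1))\<bar>. i \<in># mset_set {0..<Suc n} #} =
        add_mset d M"
      using that(5) by simp
  qed
  show ?thesis
    using assms
  proof (induction rule: walk.induct)
    case (start S u)
    then show ?case by (intro exI[of _ "[u]"]) auto
  next
    case (step_1 u v S a b c w T)
    from step_1(4) obtain xs where "length xs = Suc (a + b + c)" "xs ! 0 = u"
      "xs ! (a + b + c) = v" "S \<subseteq> set xs"
      "{# nat \<bar>int (xs ! i) - int (xs ! (i + 1))\<bar>. i \<in># mset_set {0..<a + b + c} #} =
        replicate_mset a 1 + replicate_mset b x + replicate_mset c (x + 1)" by blast
    from extend[OF this step_1(2,3)] show ?case by simp
  next
    case (step_x u v S a b c w T)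
    from step_x(4) obtain xs where "length xs = Suc (a + b + c)" "xs ! 0 = u"
      "xs ! (a + b + c) = v" "S \<subseteq> set xs"
      "{# nat \<bar>int (xs ! i) - int (xs ! (i + 1))\<bar>. i \<in># mset_set {0..<a + b + c} #} =
        replicate_mset a 1 + replicate_mset b x + replicate_mset c (x + 1)" by blast
    from extend[OF this step_x(2,3)] show ?case by simp
  next
    case (step_y u v S a b c w T)
    from step_y(4) obtain xs where "length xs = Suc (a + b + c)" "xs ! 0 = u"
      "xs ! (a + b + c) = v" "S \<subseteq> set xs"
      "{# nat \<bar>int (xs ! i) - int (xs ! (i + 1))\<bar>. i \<in># mset_set {0..<a + b + c} #} =
        replicate_mset a 1 + replicate_mset b x + replicate_mset c (x + 1)" by blast
    from extend[OF this step_y(2,3)] show ?case by simp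
  qed
qed

lemma std_imp_realization:
  assumes "std x a b c"
  shows "\<exists>xs. standard_linear_realization xs
    (replicate_mset a 1 + replicate_mset b x + replicate_mset c (x + 1))"
proof -
  let ?n = "a + b + c"
  from assms obtain v where "walk x 0 v {0..?n} a b c" by (auto simp: std_def)
  from walk_imp_list[OF this] obtain xs where xs: "length xs = Suc ?n" "xs ! 0 = 0"
    "{0..?n} \<subseteq> set xs"
    "{# nat \<bar>int (xs ! i) - int (xs ! (i + 1))\<bar>. i \<in># mset_set {0..<?n} #} =
      replicate_mset a 1 + replicate_mset b x + replicate_mset c (x + 1)" by blast
  have "card {0..?n} \<le> card (set xs)" using xs(3) by (intro card_mono) auto
  with card_length[of xs] xs(1) have card: "card (set xs) = Suc ?n" by simp
  have "{0..?n} = set xs" by (rule card_subset_eq) (use xs card in auto)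
  moreover have "distinct xs" by (rule card_distinct) (use xs card in auto)
  ultimately show ?thesis
    using xs by (intro exI[of _ xs])
      (auto simp: standard_linear_realization_def linear_realization_def)
qed

section \<open>Paths on two rows\<close>

text \<open>
  There are \<open>p\<close> zigzag steps \<open>+(x+1), -x\<close>, then \<open>m\<close> detours \<open>+(x+1), +1, -(x+1), +1\<close>, then \<open>s\<close>
  detours \<open>+1, +x, +1, -x\<close>.
\<close>

lemma walk_strip:
  "walk x 0 (p + 2 * m + 2 * s) ({0..p + 2 * m + 2 * s} \<union> {x + 1..<x + 1 + (p + 2 * m + 2 * s)})
     (2 * m + 2 * s) (p + 2 * s) (p + 2 * m)"
proof (induction s)
  case 0
  show ?case
  proof (induction m)
    case 0
    show ?case
    proof (induction p)
      case 0
      then show ?case by (auto intro: walk_point)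
    next
      case (Suc p)
      have "walk x 0 (x + 1 + p) (insert (x + 1 + p) ({0..p} \<union> {x + 1..<x + 1 + p})) 0 p (Suc p)"
        by (rule step_y[of x 0 p "{0..p} \<union> {x + 1..<x + 1 + p}"]) (use Suc in auto)
      then have "walk x 0 (Suc p) ({0..Suc p} \<union> {x + 1..<x + 1 + Suc p}) 0 (Suc p) (Suc p)"
        by (rule walk_join_x[OF _ walk_point]) auto
      then show ?case by simp
    qed
  next
    case (Suc m)
    let ?k = "p + 2 * m"
    let ?S = "{0..?k} \<union> {x + 1..<x + 1 + ?k}"
    have "walk x 0 ?k ?S (2 * m) p (p + 2 * m)" using Suc by simp
    from step_y[OF this, of "x + 1 + ?k", OF _ order_refl]
    have "walk x 0 (x + 1 + ?k) (insert (x + 1 + ?k) ?S) (2 * m) p (Suc (p + 2 * m))" by simp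
    from step_1[OF this, of "x + 2 + ?k", OF _ order_refl]
    have "walk x 0 (x + 2 + ?k) (insert (x + 2 + ?k) (insert (x + 1 + ?k) ?S))
      (Suc (2 * m)) p (Suc (p + 2 * m))" by simp
    from step_y[OF this, of "?k + 1", OF _ order_refl]
    have "walk x 0 (?k + 1) (insert (?k + 1) (insert (x + 2 + ?k) (insert (x + 1 + ?k) ?S)))
      (Suc (2 * m)) p (Suc (Suc (p + 2 * m)))" by simp
    then have "walk x 0 (?k + 2) ({0..?k + 2} \<union> {x + 1..<x + 1 + (?k + 2)})
      (2 * m + 2) p (p + 2 * m + 2)"
      by (rule walk_join_1[OF _ walk_point]) auto
    then show ?case by (simp add: algebra_simps)
  qed
next
  case (Suc s)
  let ?k = "p + 2 * m + 2 * s"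
  let ?S = "{0..?k} \<union> {x + 1..<x + 1 + ?k}"
  from step_1[OF Suc, of "?k + 1", OF _ order_refl]
  have "walk x 0 (?k + 1) (insert (?k + 1) ?S)
    (Suc (2 * m + 2 * s)) (p + 2 * s) (p + 2 * m)" by simp
  from step_x[OF this, of "?k + 1 + x", OF _ order_refl]
  have "walk x 0 (?k + 1 + x) (insert (?k + 1 + x) (insert (?k + 1) ?S))
    (Suc (2 * m + 2 * s)) (Suc (p + 2 * s)) (p + 2 * m)" by simp
  from step_1[OF this, of "?k + 2 + x", OF _ order_refl]
  have "walk x 0 (?k + 2 + x) (insert (?k + 2 + x) (insert (?k + 1 + x) (insert (?k + 1) ?S)))
    (Suc (Suc (2 * m + 2 * s))) (Suc (p + 2 * s)) (p + 2 * m)" by simp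
  then have "walk x 0 (?k + 2) ({0..?k + 2} \<union> {x + 1..<x + 1 + (?k + 2)})
    (2 * m + 2 * s + 2) (p + 2 * s + 2) (p + 2 * m)"
    by (rule walk_join_x[OF _ walk_point]) auto
  then show ?case by (simp add: algebra_simps)
qed

text \<open>As \<open>x - r\<close> is even, \<open>r\<close> zigzag steps and
  \<open>(x - r) div 2\<close> detours of the first kind end exactly at \<open>x\<close>. Only
  \<open>2 * x + 1\<close> is then missing, and it is one step \<open>x + 1\<close> away.\<close>

lemma perfect_strip:
  assumes "odd x" "odd r" "r \<le> x"
  shows "perfect x (x - r) r (x + 1)"
proof -
  define m where "m = (x - r) div 2"
  have m: "x - r = 2 * m" using assms by (simp add: m_def)
  then have x: "x = r + 2 * m" using assms by simp
  have "walk x 0 x ({0..x} \<union> {x + 1..<x + 1 + x}) (x - r) r x"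
    using walk_strip[of x r m 0] x by simp
  then have "walk x 0 (2 * x + 1) {0..2 * x + 1} (x - r) r (Suc x)"
    by (rule walk_join_y[OF _ walk_point]) auto
  moreover have "x - r + r + (x + 1) = 2 * x + 1" using assms by simp
  ultimately show ?thesis unfolding perfect_def by (simp only:) simp
qed

text \<open>After the strip: up the lower row to \<open>x\<close>, over to \<open>2 * x\<close>,
  down the upper row. Here the \<open>x\<close> outnumber the \<open>x + 1\<close> by an odd
  number.\<close>

lemma std_strip_via_x:
  assumes "k = p + 2 * s" "k < x"
  shows "std x (2 * x - 1 - 2 * p - 2 * s) (k + 1) p"
proof -
  let ?S = "{0..k} \<union> {x + 1..<x + 1 + k}"
  have w: "walk x 0 k ?S (2 * s) k p"
    using walk_strip[of x p 0 s] assms(1) by simp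
  have "walk x k (x + 1 + k) ({k..x} \<union> {x + 1 + k..2 * x}) (2 * x - 1 - 2 * k) 1 0"
    by (rule walk_join_x[OF walk_run_up[of k x] walk_run_down[of "x + 1 + k" "2 * x"]])
       (use assms in auto)
  from w this have "walk x 0 (x + 1 + k) {0..2 * x} (2 * x - 1 - 2 * p - 2 * s) (k + 1) p"
    by (rule walk_append) (use assms in auto)
  then show ?thesis by (rule stdI) (use assms in auto)
qed

text \<open>After the strip: cross to the upper row, climb to \<open>2 * x\<close>, drop to
  \<open>x\<close>, descend the lower row. The closing part uses one step of each long length, which
  fits equal parity and positive counts.\<close>

lemma std_strip_via_top:
  assumes "k = p + 2 * m + 2 * s" "k < x"
  shows "std x (2 * x - 2 - 2 * p - 2 * m - 2 * s) (p + 2 * s + 1) (p + 2 * m + 1)"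
proof -
  let ?S = "{0..k} \<union> {x + 1..<x + 1 + k}"
  have w: "walk x 0 k ?S (2 * m + 2 * s) (p + 2 * s) (p + 2 * m)"
    using walk_strip[of x p m s] assms(1) by simp
  have "walk x (x + 1 + k) (k + 1) ({x + 1 + k..2 * x} \<union> {k + 1..x}) (2 * x - 2 - 2 * k) 1 0"
    by (rule walk_join_x[OF walk_run_up[of "x + 1 + k" "2 * x"] walk_run_down[of "k + 1" x]])
       (use assms in auto)
  with w have "walk x 0 (k + 1) {0..2 * x} (2 * x - 2 - 2 * p - 2 * m - 2 * s)
      (p + 2 * s + 1) (p + 2 * m + 1)"
    by (rule walk_join_y) (use assms in auto)
  then show ?thesis by (rule stdI) (use assms in auto)
qed

text \<open>As in \<open>std_strip_via_x\<close>, but crossing from \<open>x\<close> to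
  \<open>2 * x + 1\<close>, so the \<open>x + 1\<close> outnumber the \<open>x\<close> by an odd
  number.\<close>

lemma std_strip_via_y:
  assumes "k = p + 2 * m" "k \<le> x"
  shows "std x (2 * x - 2 * p - 2 * m) p (k + 1)"
proof -
  let ?S = "{0..k} \<union> {x + 1..<x + 1 + k}"
  have w: "walk x 0 k ?S (2 * m) p k"
    using walk_strip[of x p m 0] assms(1) by simp
  have "walk x k (x + 1 + k) ({k..x} \<union> {x + 1 + k..2 * x + 1}) (2 * x - 2 * k) 0 1"
    by (rule walk_join_y[OF walk_run_up[of k x] walk_run_down[of "x + 1 + k" "2 * x + 1"]])
       (use assms in auto)
  from w this have "walk x 0 (x + 1 + k) {0..2 * x + 1} (2 * x - 2 * p - 2 * m) p (k + 1)"
    by (rule walk_append) (use assms in auto)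
  then show ?thesis by (rule stdI) (use assms in auto)
qed


text \<open>Without steps \<open>x + 1\<close> the rows have length \<open>x\<close>: detours
  \<open>+x, +1, -x, +1\<close> are followed by a run to the end of the lower row.\<close>

lemma std_x_even:
  assumes "even r" "r < x"
  shows "std x (x - 1) r 0"
proof -
  have "walk x 0 (2 * m) ({0..2 * m} \<union> {x..<x + 2 * m}) (2 * m) (2 * m) 0" for m
  proof (induction m)
    case 0
    then show ?case by (auto intro: walk_point)
  next
    case (Suc m)
    let ?k = "2 * m"
    let ?S = "{0..?k} \<union> {x..<x + ?k}"
    from step_x[OF Suc, of "x + ?k", OF _ order_refl]
    have "walk x 0 (x + ?k) (insert (x + ?k) ?S) ?k (Suc ?k) 0" by simp
    from step_1[OF this, of "x + ?k + 1", OF _ order_refl]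
    have "walk x 0 (x + ?k + 1) (insert (x + ?k + 1) (insert (x + ?k) ?S)) (Suc ?k) (Suc ?k) 0"
      by simp
    from step_x[OF this, of "?k + 1", OF _ order_refl]
    have "walk x 0 (?k + 1) (insert (?k + 1) (insert (x + ?k + 1) (insert (x + ?k) ?S)))
      (Suc ?k) (Suc (Suc ?k)) 0" by simp
    then have "walk x 0 (?k + 2) ({0..?k + 2} \<union> {x..<x + (?k + 2)}) (?k + 2) (?k + 2) 0"
      by (rule walk_join_1[OF _ walk_point]) auto
    then show ?case by (simp add: algebra_simps)
  qed
  from this[of "r div 2"] have "walk x 0 r ({0..r} \<union> {x..<x + r}) r r 0"
    using assms(1) by simp
  from walk_append[OF this walk_run_up[of r "x - 1"] order_refl refl refl refl]
  have "walk x 0 (x - 1) ({0..r} \<union> {x..<x + r} \<union> {r..x - 1}) (x - 1) r 0"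
    using assms(2) by simp
  then show ?thesis by (rule stdI) (use assms in auto)
qed

section \<open>Paths through residue classes\<close>

text \<open>A boustrophedon through the residue classes modulo \<open>x\<close>, all of height
  \<open>q + 1\<close>. Their number is odd, so the last one is climbed and ends at the largest
  label.\<close>

lemma perfect_x_columns:
  assumes "odd x"
  shows "perfect x (x - 1) (q * x) 0"
proof -
  let ?col = "\<lambda>u. {u + x * t |t. t \<le> q}"
  have "walk x 0 (2 * m) (\<Union>j<2 * m. ?col j) (2 * m) (2 * m * q) 0" for m
  proof (induction m)
    case 0
    then show ?case by (auto intro: start)
  next
    case (Suc m)
    let ?k = "2 * m"
    have "walk x ?k (?k + 1) (?col ?k \<union> ?col (?k + 1)) 1 (q + q) 0"
      by (rule walk_join_1[OF walk_column_x walk_rev[OF walk_column_x]]) auto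
    from walk_append[OF Suc this order_refl refl refl refl]
    have "walk x 0 (?k + 1) ((\<Union>j<?k. ?col j) \<union> (?col ?k \<union> ?col (?k + 1)))
      (?k + 1) (?k * q + (q + q)) 0" by simp
    then have "walk x 0 (?k + 2) (\<Union>j<?k + 2. ?col j) (Suc (?k + 1)) (?k * q + (q + q)) 0"
    proof (rule step_1)
      have "{..<?k + 2} = insert (?k + 1) (insert ?k {..<?k})" by auto
      then show "(\<Union>j<?k + 2. ?col j) \<subseteq>
          insert (?k + 2) ((\<Union>j<?k. ?col j) \<union> (?col ?k \<union> ?col (?k + 1)))"
        by (simp only: UN_insert) blast
    qed simp
    then show ?case by (simp add: algebra_simps)
  qed
  from this[of "x div 2"] have "walk x 0 (x - 1) (\<Union>j<x - 1. ?col j) (x - 1) ((x - 1) * q) 0"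
    using assms by (simp add: odd_two_times_div_two_nat)
  from walk_append[OF this walk_column_x[of x "x - 1" q] order_refl refl refl refl]
  have w: "walk x 0 (x - 1 + x * q) ((\<Union>j<x - 1. ?col j) \<union> ?col (x - 1)) (x - 1) ((x - 1) * q + q) 0"
    by simp
  have x: "x > 0" using assms by (rule odd_pos)
  have q: "(x - 1) * q + q = q * x" using x by (cases x) auto
  have "{0..x - 1 + q * x} \<subseteq> (\<Union>j<x - 1. ?col j) \<union> ?col (x - 1)"
  proof
    fix v assume "v \<in> {0..x - 1 + q * x}"
    then have "v < (q + 1) * x" using x by auto
    then have "v div x < q + 1" using less_mult_imp_div_less by blast
    then have "v \<in> ?col (v mod x)"
      by (intro CollectI exI[of _ "v div x"]) (simp add: ac_simps)
    moreover have "v mod x < x - 1 \<or> v mod x = x - 1"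
      using mod_less_divisor[OF x, of v] by linarith
    ultimately show "v \<in> (\<Union>j<x - 1. ?col j) \<union> ?col (x - 1)" by auto
  qed
  from walk_mono[OF w[unfolded q] this] show ?thesis
    unfolding perfect_def by (simp add: ac_simps)
qed

text \<open>
  The labels up to \<open>x + (x+1) g + s\<close> that are congruent to \<open>u\<close> modulo \<open>x + 1\<close>. The tops of adjacent
  columns differ by \<open>1\<close>, except that the tops of columns \<open>s - 1\<close> and \<open>s\<close> differ by \<open>x\<close>; so the parity
  of \<open>s\<close> and the direction of travel decide whether the path uses an \<open>x\<close>.
\<close>

definition column :: "nat \<Rightarrow> nat \<Rightarrow> nat \<Rightarrow> nat \<Rightarrow> nat set" where
  "column x g s u = {u + (x + 1) * t |t. t \<le> g + of_bool (u < s)}"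

lemma walk_column:
  "walk x u (u + (x + 1) * (g + of_bool (u < s))) (column x g s u) 0 0 (g + of_bool (u < s))"
  unfolding column_def by (rule walk_column_y)

lemma columns_cover:
  assumes "s \<le> x"
  shows "{0..x + ((x + 1) * g + s)} \<subseteq> (\<Union>j\<le>x. column x g s j)"
proof
  fix v assume "v \<in> {0..x + ((x + 1) * g + s)}"
  then have v: "v \<le> x + ((x + 1) * g + s)" by simp
  let ?j = "v mod (x + 1)" and ?t = "v div (x + 1)"
  have eq: "v = ?j + (x + 1) * ?t" by (simp only: mod_mult_div_eq)
  have "?t \<le> g + of_bool (?j < s)"
  proof (rule ccontr)
    assume "\<not> ?thesis"
    \<comment> \<open>Columns left of \<open>s\<close> are one label taller; in either case
      \<open>v\<close> would exceed the bound.\<close>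
    then consider "?t \<ge> g + 2" | "?t \<ge> g + 1" "?j \<ge> s" 
      by (cases "?j < s") auto
    then show False
    proof cases
      case 1
      from mult_le_mono2[OF this, of "x + 1"] have "(x + 1) * g + 2 * (x + 1) \<le> v"
        using eq by (simp add: algebra_simps)
      then show False using v assms by simp
    next
      case 2
      from mult_le_mono2[OF this(1), of "x + 1"] have "(x + 1) * g + (x + 1) + ?j \<le> v"
        using eq by (simp add: algebra_simps)
      then show False using v 2(2) by simp
    qed
  qed
  then have "v \<in> column x g s ?j"
    unfolding column_def by (intro CollectI exI[of _ ?t] conjI eq)
  moreover have "?j \<le> x" using mod_less_divisor[of "x + 1" v] by simp
  ultimately show "v \<in> (\<Union>j\<le>x. column x g s j)" by blast
qed

lemma walk_column_pair_right:
  "walk x (2 * m) (2 * m + 1) (column x g s (2 * m) \<union> column x g s (2 * m + 1))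
     (1 - of_bool (s = 2 * m + 1)) (of_bool (s = 2 * m + 1))
     (2 * g + of_bool (2 * m < s) + of_bool (2 * m + 1 < s))"
proof (cases "s = 2 * m + 1")
  case True
  show ?thesis
    by (rule walk_join_x[OF walk_column[of x "2 * m" g s] walk_rev[OF walk_column[of x "2 * m + 1" g s]]])
       (use True in auto)
next
  case False
  then have "(2 * m < s) = (2 * m + 1 < s)" by auto
  then show ?thesis
    by (intro walk_join_1[OF walk_column[of x "2 * m" g s] walk_rev[OF walk_column[of x "2 * m + 1" g s]]])
       (use False in auto)
qed

text \<open>Tops are crossed only from an even column to the next odd one, so an \<open>x\<close>
  occurs exactly when the drop before column \<open>s\<close> has \<open>s\<close> odd.\<close>

lemma walk_snake_right:
  "walk x 0 (2 * m + 1) (\<Union>j\<le>2 * m + 1. column x g s j)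
     (2 * m + 1 - of_bool (odd s \<and> s \<le> 2 * m + 1)) (of_bool (odd s \<and> s \<le> 2 * m + 1))
     ((2 * m + 2) * g + min s (2 * m + 2))"
proof (induction m)
  case 0
  show ?case
    by (rule walk_cong[OF walk_column_pair_right[of x 0 g s]])
       (auto simp: le_Suc_eq elim: oddE)
next
  case (Suc m)
  show ?case
    by (rule walk_join_1[OF Suc walk_column_pair_right[of x "Suc m" g s]])
       (auto simp: le_Suc_eq min_def elim!: oddE)
qed

lemma walk_column_pair_left:
  "walk x (2 * m + 2) (2 * m + 1) (column x g s (2 * m + 2) \<union> column x g s (2 * m + 1))
     (1 - of_bool (s = 2 * m + 2)) (of_bool (s = 2 * m + 2))
     (2 * g + of_bool (2 * m + 1 < s) + of_bool (2 * m + 2 < s))"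
proof (cases "s = 2 * m + 2")
  case True
  show ?thesis
    by (rule walk_join_x[OF walk_column[of x "2 * m + 2" g s] walk_rev[OF walk_column[of x "2 * m + 1" g s]]])
       (use True in auto)
next
  case False
  then have "(2 * m + 1 < s) = (2 * m + 2 < s)" by auto
  then show ?thesis
    by (intro walk_join_1[OF walk_column[of x "2 * m + 2" g s] walk_rev[OF walk_column[of x "2 * m + 1" g s]]])
       (use False in auto)
qed

text \<open>Going left pairs the columns the other way, so now even \<open>s\<close> costs an
  \<open>x\<close>. Truncated \<open>s - 1\<close> counts the taller columns other than column
  0.\<close>

lemma walk_snake_left:
  "walk x (2 * m + 2) 1 (\<Union>j\<in>{1..2 * m + 2}. column x g s j)
     (2 * m + 1 - of_bool (even s \<and> 0 < s \<and> s \<le> 2 * m + 2)) (of_bool (even s \<and> 0 < s \<and> s \<le> 2 * m + 2))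
     ((2 * m + 2) * g + min (s - 1) (2 * m + 2))"
proof (induction m)
  case 0
  show ?case
    by (rule walk_cong[OF walk_column_pair_left[of x 0 g s]])
       (auto simp: le_Suc_eq elim: evenE)
next
  case (Suc m)
  show ?case
    by (rule walk_join_1[OF walk_column_pair_left[of x "Suc m" g s] Suc])
       (auto simp: le_Suc_eq min_def)
qed


lemma std_right:
  assumes "odd x" "s \<le> x"
  shows "std x (x - of_bool (odd s)) (of_bool (odd s)) ((x + 1) * g + s)"
proof -
  define m where "m = x div 2"
  have x: "x = 2 * m + 1" using assms(1) by (simp add: m_def)
  have "walk x 0 x (\<Union>j\<le>x. column x g s j) (x - of_bool (odd s)) (of_bool (odd s)) ((x + 1) * g + s)"
    by (rule walk_cong[OF walk_snake_right[of x m g s]]) (use assms x in \<open>auto simp: min_def\<close>)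
  then show ?thesis
    by (rule stdI) (use columns_cover[OF assms(2)] odd_pos[OF assms(1)] in auto)
qed

lemma std_left:
  assumes "odd x" "x \<ge> 3" "s \<le> x"
  shows "std x (x - of_bool (even s)) (of_bool (even s)) ((x + 1) * g + s)"
proof -
  define m where "m = (x - 3) div 2"
  have x: "x = 2 * m + 3" using assms by (simp add: m_def)
  let ?L = "\<Union>j\<in>{1..x - 1}. column x g s j"
  have L: "walk x (x - 1) 1 ?L (x - 2 - of_bool (even s \<and> 0 < s)) (of_bool (even s \<and> 0 < s))
      ((x - 1) * g + (s - 1))"
    by (rule walk_cong[OF walk_snake_left[of x m g s]]) (use assms x in \<open>auto simp: min_def\<close>, presburger+)
  have D: "walk x (x + (x + 1) * g) 1 (column x g s x \<union> ?L) (x - 1 - of_bool (even s \<and> 0 < s))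
      (of_bool (even s \<and> 0 < s)) (x * g + (s - 1))"
    by (rule walk_join_1[OF walk_cong[OF walk_rev[OF walk_column[of x x g s]]] L])
       (use assms x in \<open>auto simp: algebra_simps\<close>)
  have "walk x 0 1 (column x g s 0 \<union> (column x g s x \<union> ?L))
      (x - of_bool (even s)) (of_bool (even s)) ((x + 1) * g + s)"
  \<comment> \<open>The tops of columns \<open>0\<close> and \<open>x\<close> differ by
    \<open>x\<close> if \<open>s = 0\<close>; otherwise column \<open>0\<close> is taller and they
    differ by \<open>1\<close>.\<close>
  proof (cases "s = 0")
    case True
    show ?thesis
      by (rule walk_join_x[OF walk_column[of x 0 g s] D]) (use assms True in auto)
  next
    case False
    show ?thesis
      by (rule walk_join_1[OF walk_column[of x 0 g s] D]) (use assms False in auto)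
  qed
  then show ?thesis
  proof (rule stdI)
    have "{..x} = insert 0 (insert x {1..x - 1})" using assms by auto
    then have "(\<Union>j\<le>x. column x g s j) = column x g s 0 \<union> (column x g s x \<union> ?L)"
      by (simp only: UN_insert)
    moreover have "x - of_bool (even s) + of_bool (even s) + ((x + 1) * g + s) = x + ((x + 1) * g + s)"
      using assms by simp
    ultimately show "{0..x - of_bool (even s) + of_bool (even s) + ((x + 1) * g + s)}
        \<subseteq> column x g s 0 \<union> (column x g s x \<union> ?L)"
      using columns_cover[OF assms(3), of g] by (simp only:)
  qed
qed

text \<open>The two directions use an \<open>x\<close> for opposite parities of \<open>s\<close>, so
  one of them always avoids it.\<close>

lemma std_no_x:
  assumes "odd x" "x \<ge> 3"
  shows "std x x 0 c"
proof -
  have s: "c mod (x + 1) \<le> x" using mod_less_divisor[of "x + 1" c] by simp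
  have "(x + 1) * (c div (x + 1)) + c mod (x + 1) = c" by (rule mult_div_mod_eq)
  then show ?thesis
    using std_right[OF assms(1) s, of "c div (x + 1)"] std_left[OF assms s, of "c div (x + 1)"]
    by (cases "even (c mod (x + 1))") (simp_all only: of_bool_eq, simp_all)
qed

lemma std_one_x:
  assumes "odd x" "x \<ge> 3"
  shows "std x (x - 1) 1 c"
proof -
  have s: "c mod (x + 1) \<le> x" using mod_less_divisor[of "x + 1" c] by simp
  have "(x + 1) * (c div (x + 1)) + c mod (x + 1) = c" by (rule mult_div_mod_eq)
  then show ?thesis
    using std_right[OF assms(1) s, of "c div (x + 1)"] std_left[OF assms s, of "c div (x + 1)"]
    by (cases "even (c mod (x + 1))") (simp_all only: of_bool_eq, simp_all)
qed

section \<open>Combining the blocks\<close>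

text \<open>Parity and order of \<open>r\<close> and \<open>c\<close> select the closing part of the
  strip; \<open>2 \<le> r\<close> keeps the ones within \<open>2 * x - 2\<close>.\<close>

lemma std_few_x_few_y:
  assumes "odd x" "2 \<le> r" "r < x" "c \<le> x"
  shows "std x (2 * x - 2) r c"
proof (cases "even r = even c")
  case False
  show ?thesis
  proof (cases "r < c")
    case True
    define m where "m = (c - 1 - r) div 2"
    have "c = r + 2 * m + 1" using True False by (simp add: m_def)
    with std_strip_via_y[of "c - 1" r m x] assms have "std x (2 * x - 2 * r - 2 * m) r c" by simp
    then show ?thesis by (rule std_more_ones) (use assms in auto)
  next
    case r: False
    define s where "s = (r - 1 - c) div 2"
    have "r = c + 2 * s + 1" using r False by (simp add: s_def) presburger
    with std_strip_via_x[of "r - 1" c s x] assms have "std x (2 * x - 1 - 2 * c - 2 * s) r c" by simp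
    then show ?thesis by (rule std_more_ones) (use \<open>r = c + 2 * s + 1\<close> assms in auto)
  qed
next
  case True
  consider "c = 0" | "r \<le> c" | "c > 0" "c \<le> r" by linarith
  then show ?thesis
  proof cases
    case 1
    with True assms have "std x (x - 1) r c" using std_x_even by simp
    then show ?thesis by (rule std_more_ones) (use assms in auto)
  next
    case 2
    define m where "m = (c - r) div 2"
    have m: "c = r + 2 * m" using True 2 by (simp add: m_def)
    \<comment> \<open>Only \<open>r - 1\<close> zigzag steps, because the closing part uses one more
      \<open>x\<close> and one more \<open>x + 1\<close>.\<close>
    have "std x (2 * x - 2 - 2 * (r - 1) - 2 * m - 2 * 0) (r - 1 + 2 * 0 + 1) (r - 1 + 2 * m + 1)"
      by (rule std_strip_via_top[OF refl]) (use m assms in auto)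
    then have "std x (2 * x - 2 - 2 * (r - 1) - 2 * m - 2 * 0) r c" using m assms by simp
    then show ?thesis by (rule std_more_ones) simp
  next
    case 3
    define s where "s = (r - c) div 2"
    have s: "r = c + 2 * s" using True 3 by (simp add: s_def)
    have "std x (2 * x - 2 - 2 * (c - 1) - 2 * 0 - 2 * s) (c - 1 + 2 * s + 1) (c - 1 + 2 * 0 + 1)"
      by (rule std_strip_via_top[OF refl]) (use s 3 assms in auto)
    then have "std x (2 * x - 2 - 2 * (c - 1) - 2 * 0 - 2 * s) r c" using s 3 by simp
    then show ?thesis by (rule std_more_ones) simp
  qed
qed

lemma std_few_x:
  assumes "odd x" "x \<ge> 3" "r < x"
  shows "std x (2 * x - 2) r c"
proof -
  consider "r = 0" | "r = 1" | "2 \<le> r" "c \<le> x" | "2 \<le> r" "x + 1 \<le> c" "odd r"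
    | "2 \<le> r" "x + 1 \<le> c" "even r" by linarith
  then show ?thesis
  proof cases
    case 1
    then show ?thesis using std_more_ones[OF std_no_x[OF assms(1,2)]] assms by simp
  next
    case 2
    then show ?thesis using std_more_ones[OF std_one_x[OF assms(1,2)]] assms by simp
  next
    case 3
    then show ?thesis using std_few_x_few_y assms by simp
  next
    case 4
    have "std x (x - r + x) (r + 0) (x + 1 + (c - (x + 1)))"
      by (rule perfect_std[OF perfect_strip std_no_x]) (use 4 assms in auto)
    then have "std x (x - r + x) r c" using 4 by simp
    then show ?thesis by (rule std_more_ones) (use 4 assms in auto)
  next
    case 5
    \<comment> \<open>The strip takes an odd number of \<open>x\<close>, so one is left over for
      \<open>std_one_x\<close>.\<close>
    have "std x (x - (r - 1) + (x - 1)) (r - 1 + 1) (x + 1 + (c - (x + 1)))"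
      by (rule perfect_std[OF perfect_strip std_one_x]) (use 5 assms in auto)
    then have "std x (x - (r - 1) + (x - 1)) r c" using 5 by simp
    then show ?thesis by (rule std_more_ones) (use 5 assms in auto)
  qed
qed

lemma std_3x:
  assumes "odd x" "x \<ge> 3"
  shows "std x (3 * x - 3) b c"
proof -
  have "std x (x - 1 + (2 * x - 2)) (b div x * x + b mod x) (0 + c)"
    by (rule perfect_std[OF perfect_x_columns std_few_x]) (use assms in auto)
  moreover have "x - 1 + (2 * x - 2) = 3 * x - 3" using assms by simp
  ultimately show ?thesis by simp
qed

lemma std_many_y:
  assumes "odd x" "x \<ge> 3" "4 * b \<le> 3 * c"
  shows "std x (2 * x - 2) b c"
proof -
  let ?q = "b div x"
  \<comment> \<open>The ratio 4/3 enters here: \<open>(x + 1) / x\<close> is at most 4/3 for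
    \<open>x \<ge> 3\<close>, so \<open>c\<close> suffices for \<open>?q\<close> blocks without
    ones.\<close>
  have "3 * (?q * (x + 1)) \<le> 4 * (?q * x)"
    using assms(2) mult_le_mono2[OF assms(2), of ?q] by (simp add: algebra_simps)
  also have "\<dots> \<le> 4 * b" by simp
  finally have c: "?q * (x + 1) \<le> c" using assms(3) by linarith
  have "perfect x (?q * (x - x)) (?q * x) (?q * (x + 1))"
    by (rule perfect_power[OF perfect_strip]) (use assms in auto)
  from perfect_std[OF this std_few_x[OF assms(1,2), of "b mod x" "c - ?q * (x + 1)"]] c assms(2)
  show ?thesis by simp
qed

theorem theorem3p9:
  fixes x a b c :: nat
  assumes "x \<ge> 3" and "odd x"
    and "a \<ge> 3 * x - 3 \<or> a \<ge> b + 2 * x - 3 \<or> (real c \<ge> 4 * real b / 3 \<and> a \<ge> 2 * x - 2)"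
  shows "\<exists>xs. standard_linear_realization xs
    (replicate_mset a 1 + replicate_mset b x + replicate_mset c (x + 1))"
proof (rule std_imp_realization)
  \<comment> \<open>The bound \<open>b + 2 * x - 3\<close> is at least \<open>3 * x - 3\<close> if
    \<open>b \<ge> x\<close>, at least \<open>2 * x - 2\<close> if \<open>0 < b < x\<close>, and at
    least \<open>x\<close> if \<open>b = 0\<close>.\<close>
  consider "a \<ge> 3 * x - 3" | "b = 0" "a \<ge> x" | "b < x" "a \<ge> 2 * x - 2"
    | "4 * real b / 3 \<le> real c" "a \<ge> 2 * x - 2"
    using assms by linarith
  then show "std x a b c"
  proof cases
    case 1
    then show ?thesis by (rule std_more_ones[OF std_3x[OF assms(2,1)]])
  next
    case 2
    then show ?thesis using std_more_ones[OF std_no_x[OF assms(2,1)]] by simp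
  next
    case 3
    then show ?thesis using std_more_ones[OF std_few_x[OF assms(2,1)]] by simp
  next
    case 4
    have "4 * b \<le> 3 * c" using 4(1) by linarith
    with 4(2) show ?thesis using std_more_ones[OF std_many_y[OF assms(2,1)]] by simp
  qed
qed

end
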